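(* Let $(X,p)$ be a diagram in $\mathbb{R}^n$ with $|V|$ vertices and $|E|$ edges, let $|S|$ be its number of self stresses and $|M|$ its number of linkage mechanisms. Then the generalized Maxwell's Rule holds: $$n|V|-|E|=\binom{n+1}{2}+|M|-|S|.$$
   Context: A diagram $(X,p)$ in $\mathbb{R}^n$ is a finite regular cell complex $X$ (only its vertices $V$ and edges $E$ matter here) with an injective map $p:V\to\mathbb{R}^n$, $v\mapsto p_v$. A sign $[v:e]\in\{\pm1\}$ is fixed for each vertex $v$ of each edge $e$, with $[u:e][v:e]=-1$ for the two endpoints $u,v$ of $e$. For an edge $e$ with endpoints $u,v$ let $\tau_e$ be the unit vector in the direction of $[u:e]p_u+[v:e]p_v$. The force cosheaf $\mathcal F$ of $(X,p)$ has stalk $\mathbb{R}^n$ on each vertex, stalk $\mathbb{R}$ on each edge $e$, zero on higher cells, and extension maps $\mathbb{R}\to\mathbb{R}^n$, $1\mapsto\tau_e$. Its chain complex is $\partial:\mathbb{R}^E\to(\mathbb{R}^n)^V$, $(\partial w)_v=\sum_{e:\,v\text{ is an endpoint of }e}[v:e]\,w_e\,\tau_e$, with $H_1\mathcal F=\ker\partial$ (self stresses) and $H_0\mathcal F=\operatorname{coker}\partial$ (constrained degrees of freedom). The number of self stresses is $|S|=\dim H_1\mathcal F$. The number of mechanisms $|M|$ is the number of degrees of freedom in $H_0\mathcal F$ beyond the $\binom{n+1}{2}$ Euclidean motions (global translations and rotations), that is, $\dim H_0\mathcal F=\binom{n+1}{2}+|M|$. *)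

theory Defs
  imports "HOL-Analysis.Analysis" "HOL-Algebra.AbelCoset" "Jordan_Normal_Form.VS_Connect"
begin

no_notation Congruence.eq_closure_of (\<open>closure'_of\<index>\<close>)

section \<open>Finite regular cell complexes\<close>

definition unit_disc :: "nat \<Rightarrow> (nat \<Rightarrow> real) topology" where
  "unit_disc k = subtopology (Euclidean_space k) {x. (\<Sum>i<k. (x i)\<^sup>2) \<le> 1}"

definition open_unit_disc :: "nat \<Rightarrow> (nat \<Rightarrow> real) set" where
  "open_unit_disc k = {x \<in> topspace (Euclidean_space k). (\<Sum>i<k. (x i)\<^sup>2) < 1}"

text \<open>Regularity: the characteristic map is a homeomorphism of the closed disc onto the closed cell.\<close>

definition regular_cell :: "'a topology \<Rightarrow> nat \<Rightarrow> 'a set \<Rightarrow> bool" where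
  "regular_cell X k \<sigma> \<longleftrightarrow>
     (\<exists>h. homeomorphic_map (unit_disc k) (subtopology X (X closure_of \<sigma>)) h \<and>
          h ` open_unit_disc k = \<sigma>)"

text \<open>A complex is given by its underlying space, its set of open cells and their dimensions.\<close>

record 'a cell_complex =
  underlying_space :: "'a topology"
  cells :: "'a set set"
  cell_dim :: "'a set \<Rightarrow> nat"

definition finite_regular_cell_complex :: "'a cell_complex \<Rightarrow> bool" where
  "finite_regular_cell_complex X \<longleftrightarrow>
     Hausdorff_space (underlying_space X) \<and>
     finite (cells X) \<and>
     disjoint (cells X) \<and>
     \<Union>(cells X) = topspace (underlying_space X) \<and>
     (\<forall>\<sigma>\<in>cells X. regular_cell (underlying_space X) (cell_dim X \<sigma>) \<sigma> \<and>
        (underlying_space X) closure_of \<sigma> - \<sigma> \<subseteq>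
          \<Union>{\<tau> \<in> cells X. cell_dim X \<tau> < cell_dim X \<sigma>})"

definition vertices :: "'a cell_complex \<Rightarrow> 'a set set" where
  "vertices X = {v \<in> cells X. cell_dim X v = 0}"

definition edges :: "'a cell_complex \<Rightarrow> 'a set set" where
  "edges X = {e \<in> cells X. cell_dim X e = 1}"

definition endpoints :: "'a cell_complex \<Rightarrow> 'a set \<Rightarrow> 'a set set" where
  "endpoints X e = {v \<in> vertices X. v \<subseteq> (underlying_space X) closure_of e}"


section \<open>Diagrams\<close>

text \<open>The sign \<open>[v:e]\<close> is written \<open>s v e\<close>.\<close>

definition incidence_signs :: "'a cell_complex \<Rightarrow> ('a set \<Rightarrow> 'a set \<Rightarrow> real) \<Rightarrow> bool" where
  "incidence_signs X s \<longleftrightarrow>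
     (\<forall>e\<in>edges X. (\<forall>v\<in>endpoints X e. s v e \<in> {1, -1}) \<and>
        (\<forall>u\<in>endpoints X e. \<forall>v\<in>endpoints X e. u \<noteq> v \<longrightarrow> s u e * s v e = -1))"

definition diagram ::
  "'a cell_complex \<Rightarrow> ('a set \<Rightarrow> 'a set \<Rightarrow> real) \<Rightarrow> ('a set \<Rightarrow> real ^ 'n) \<Rightarrow> bool" where
  "diagram X s p \<longleftrightarrow>
     finite_regular_cell_complex X \<and> incidence_signs X s \<and> inj_on p (vertices X)"

text \<open>Below, \<^const>\<open>sgn\<close> normalizes a vector to unit length.\<close>

definition edge_direction ::
  "'a cell_complex \<Rightarrow> ('a set \<Rightarrow> 'a set \<Rightarrow> real) \<Rightarrow> ('a set \<Rightarrow> real ^ 'n) \<Rightarrow> 'a set \<Rightarrow> real ^ 'n" where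
  "edge_direction X s p e = sgn (\<Sum>v\<in>endpoints X e. s v e *\<^sub>R p v)"


section \<open>Real vector spaces of chains, and quotients\<close>

text \<open>Functions on \<open>A\<close> are represented by functions vanishing outside \<open>A\<close>. The fields
  \<open>mult\<close> and \<open>one\<close> of the module record play no role.\<close>

definition chain_space :: "'c set \<Rightarrow> (real, 'c \<Rightarrow> 'b::real_vector) module" where
  "chain_space A =
     \<lparr>carrier = {f. \<forall>x. x \<notin> A \<longrightarrow> f x = 0}, mult = undefined, one = undefined,
      zero = (\<lambda>x. 0), add = (\<lambda>f g x. f x + g x), smult = (\<lambda>c f x. c *\<^sub>R f x)\<rparr>"

definition quotient_space :: "('r, 'm) module \<Rightarrow> 'm set \<Rightarrow> ('r, 'm set) module" where
  "quotient_space V W =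
     \<lparr>carrier = a_rcosets\<^bsub>V\<^esub> W, mult = undefined, one = undefined,
      zero = W, add = set_add V, smult = (\<lambda>c A. \<Union>x\<in>A. W +>\<^bsub>V\<^esub> (c \<odot>\<^bsub>V\<^esub> x))\<rparr>"


section \<open>Homology of the force cosheaf\<close>

definition force_C1 :: "'a cell_complex \<Rightarrow> (real, 'a set \<Rightarrow> real) module" where
  "force_C1 X = chain_space (edges X)"

definition force_C0 :: "'a cell_complex \<Rightarrow> (real, 'a set \<Rightarrow> real ^ 'n) module" where
  "force_C0 X = chain_space (vertices X)"

definition force_boundary ::
  "'a cell_complex \<Rightarrow> ('a set \<Rightarrow> 'a set \<Rightarrow> real) \<Rightarrow> ('a set \<Rightarrow> real ^ 'n) \<Rightarrow>
     ('a set \<Rightarrow> real) \<Rightarrow> ('a set \<Rightarrow> real ^ 'n)" where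
  "force_boundary X s p w =
     (\<lambda>v. if v \<in> vertices X
          then \<Sum>e\<in>{e \<in> edges X. v \<in> endpoints X e}. (s v e * w e) *\<^sub>R edge_direction X s p e
          else 0)"

text \<open>The stalks on cells of dimension at least two vanish, so there are no boundaries in degree 1.\<close>

definition force_H1 ::
  "'a cell_complex \<Rightarrow> ('a set \<Rightarrow> 'a set \<Rightarrow> real) \<Rightarrow> ('a set \<Rightarrow> real ^ 'n) \<Rightarrow>
     (real, 'a set \<Rightarrow> real) module" where
  "force_H1 X s p =
     (force_C1 X)\<lparr>carrier := {w \<in> carrier (force_C1 X). force_boundary X s p w = (\<lambda>v. 0)}\<rparr>"

definition force_H0 ::
  "'a cell_complex \<Rightarrow> ('a set \<Rightarrow> 'a set \<Rightarrow> real) \<Rightarrow> ('a set \<Rightarrow> real ^ 'n) \<Rightarrow>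
     (real, ('a set \<Rightarrow> real ^ 'n) set) module" where
  "force_H0 X s p = quotient_space (force_C0 X) (force_boundary X s p ` carrier (force_C1 X))"

definition num_self_stresses ::
  "'a cell_complex \<Rightarrow> ('a set \<Rightarrow> 'a set \<Rightarrow> real) \<Rightarrow> ('a set \<Rightarrow> real ^ 'n) \<Rightarrow> nat" where
  "num_self_stresses X s p = vectorspace.dim class_ring (force_H1 X s p)"

text \<open>The number of mechanisms is an integer: it is negative when \<open>H\<^sub>0\<close> has fewer than
  \<open>n + 1\<close> choose 2 degrees of freedom, as for a single vertex in the plane.\<close>

definition num_mechanisms ::
  "'a cell_complex \<Rightarrow> ('a set \<Rightarrow> 'a set \<Rightarrow> real) \<Rightarrow> ('a set \<Rightarrow> real ^ 'n) \<Rightarrow> int" where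
  "num_mechanisms X s p =
     int (vectorspace.dim class_ring (force_H0 X s p)) - int ((CARD('n) + 1) choose 2)"


section \<open>Well-definedness\<close>

lemma topspace_unit_disc: "topspace (unit_disc k) = {x. (\<forall>i\<ge>k. x i = 0) \<and> (\<Sum>i<k. (x i)\<^sup>2) \<le> 1}"
  by (auto simp: unit_disc_def topspace_Euclidean_space)

lemma regular_cell_0_singleton:
  assumes "regular_cell X 0 v" shows "\<exists>x. v = {x} \<and> x \<in> topspace X"
proof -
  obtain h where h: "homeomorphic_map (unit_disc 0) (subtopology X (X closure_of v)) h"
    "h ` open_unit_disc 0 = v" using assms unfolding regular_cell_def by blast
  have o: "open_unit_disc 0 = {\<lambda>_. 0}" "topspace (unit_disc 0) = {\<lambda>_. 0}"
    by (auto simp: open_unit_disc_def topspace_Euclidean_space topspace_unit_disc)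
  have "h ` topspace (unit_disc 0) \<subseteq> topspace X"
    using homeomorphic_imp_surjective_map[OF h(1)] by auto
  then show ?thesis using h(2) o by auto
qed

lemma card_endpoints:
  assumes X: "finite_regular_cell_complex X" and e: "e \<in> edges X"
  shows "card (endpoints X e) = 2"
proof -
  let ?T = "underlying_space X"
  have ec: "e \<in> cells X" and e1: "regular_cell ?T 1 e" using e X by (auto simp: edges_def finite_regular_cell_complex_def)
  obtain h where h: "homeomorphic_map (unit_disc 1) (subtopology ?T (?T closure_of e)) h"
    "h ` open_unit_disc 1 = e" using e1 unfolding regular_cell_def by blast
  define a b :: "nat \<Rightarrow> real" where "a = (\<lambda>i. if i = 0 then 1 else 0)" and "b = (\<lambda>i. if i = 0 then -1 else 0)"
  have ab: "a \<noteq> b" by (auto simp: a_def b_def fun_eq_iff)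
  have fe: "x = a \<or> x = b" if "\<forall>i\<ge>1. x i = 0" "(x 0)\<^sup>2 = 1" for x :: "nat \<Rightarrow> real"
  proof -
    have "x 0 = 1 \<or> x 0 = -1" using that(2) by (simp add: power2_eq_1_iff)
    then show ?thesis using that(1) by (auto simp: a_def b_def fun_eq_iff Suc_le_eq)
  qed
  have sp: "topspace (unit_disc 1) = open_unit_disc 1 \<union> {a,b}"
    "a \<notin> open_unit_disc 1" "b \<notin> open_unit_disc 1"
    using fe
    apply (auto simp: open_unit_disc_def topspace_Euclidean_space topspace_unit_disc)
    by (auto simp: a_def b_def less_le)
  have inj: "inj_on h (topspace (unit_disc 1))" using homeomorphic_imp_injective_map[OF h(1)] .
  have cl: "h ` topspace (unit_disc 1) = ?T closure_of e"
    using homeomorphic_imp_surjective_map[OF h(1)] by (simp add: closure_of_subset_topspace Int_absorb1)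
  have bd: "?T closure_of e - e = {h a, h b}"
  proof -
    have "h ` topspace (unit_disc 1) - h ` open_unit_disc 1 = h ` (topspace (unit_disc 1) - open_unit_disc 1)"
      by (rule inj_on_image_set_diff[OF inj, symmetric]) (use sp(1) in blast)+
    also have "topspace (unit_disc 1) - open_unit_disc 1 = {a, b}" using sp by blast
    finally show ?thesis using cl h(2) by simp
  qed
  have hab: "h a \<noteq> h b" using inj_onD[OF inj, of a b] sp(1) ab by blast
  have vs: "\<exists>x. v = {x} \<and> x \<in> topspace ?T" if "v \<in> vertices X" for v
    using regular_cell_0_singleton[of ?T v] that X by (auto simp: vertices_def finite_regular_cell_complex_def)
  have disj: "disjoint (cells X)" using X by (simp add: finite_regular_cell_complex_def)
  have vsing: "{h a, h b} \<subseteq> \<Union>(vertices X)"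
    using X ec e bd unfolding finite_regular_cell_complex_def vertices_def edges_def by fastforce
  then have "{h a} \<in> vertices X" "{h b} \<in> vertices X"
    using vs by auto 
  moreover have "endpoints X e \<subseteq> {{h a},{h b}}"
  proof
    fix v assume v: "v \<in> endpoints X e"
    then obtain x where x: "v = {x}" using vs unfolding endpoints_def by blast
    have "v \<noteq> e" using v e by (auto simp: endpoints_def vertices_def edges_def)
    then have "v \<inter> e = {}" using disj v ec by (auto simp: endpoints_def vertices_def disjoint_def)
    then have "x \<in> ?T closure_of e - e" using v x by (auto simp: endpoints_def)
    then show "v \<in> {{h a},{h b}}" using bd x by auto
  qed
  ultimately have "endpoints X e = {{h a},{h b}}" using bd by (auto simp: endpoints_def)
  then show ?thesis using hab by auto
qed

lemma chain_space_vs: "vectorspace class_ring (chain_space A :: (real, 'c \<Rightarrow> 'b::real_vector) module)"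
  apply (rule vs_criteria)
  apply (rule VS_Connect.class_field(1))
  apply (simp_all add: chain_space_def algebra_simps fun_eq_iff)
  subgoal by (intro allI impI, rule_tac x="\<lambda>x. - v x" in exI) simp
  done

lemma quotient_space_vs:
  assumes "subspace K W V"
  shows "vectorspace K (quotient_space V W)"
proof -
  interpret V: vectorspace K V using assms by (simp add: subspace_def)
  have sm: "submodule K W V" using assms by (simp add: subspace_def)
  have neg: "\<ominus>\<^bsub>V\<^esub> w \<in> W" if "w \<in> W" for w
    using LinearCombinations.submodule.smult_closed[OF sm, of "\<ominus>\<^bsub>K\<^esub> \<one>\<^bsub>K\<^esub>" w] that
      LinearCombinations.submodule.subset[OF sm] V.smult_minus_1 by auto
  interpret W: abelian_subgroup W V
    apply (rule abelian_subgroupI3)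
    subgoal 
      apply (intro additive_subgroup.intro V.add.subgroupI)
      using LinearCombinations.submodule.subset[OF sm] LinearCombinations.submodule.zero_closed[OF sm]
        neg LinearCombinations.submodule.m_closed[OF sm] by (auto simp: a_inv_def)
    by (rule V.abelian_group_axioms)
  have cl: "c \<odot>\<^bsub>V\<^esub> w \<in> W" if "c \<in> carrier K" "w \<in> W" for c w
    using sm that by (simp add: LinearCombinations.submodule.smult_closed)
  have sc: "(\<Union>x\<in>W +>\<^bsub>V\<^esub> v. W +>\<^bsub>V\<^esub> (c \<odot>\<^bsub>V\<^esub> x)) = W +>\<^bsub>V\<^esub> (c \<odot>\<^bsub>V\<^esub> v)"
    if c: "c \<in> carrier K" and v: "v \<in> carrier V" for c v
  proof -
    have "W +>\<^bsub>V\<^esub> (c \<odot>\<^bsub>V\<^esub> x) = W +>\<^bsub>V\<^esub> (c \<odot>\<^bsub>V\<^esub> v)" if "x \<in> W +>\<^bsub>V\<^esub> v" for x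
    proof -
      obtain w where w: "w \<in> W" "x = w \<oplus>\<^bsub>V\<^esub> v" using \<open>x \<in> _\<close> by (auto simp: a_r_coset_def r_coset_def)
      have "c \<odot>\<^bsub>V\<^esub> x \<in> W +>\<^bsub>V\<^esub> (c \<odot>\<^bsub>V\<^esub> v)"
        using w cl[OF c w(1)] c v W.a_subset by (auto simp: a_r_coset_def r_coset_def V.smult_r_distr)
      then show ?thesis using W.a_repr_independence' c v by (metis V.smult_closed)
    qed
    then show ?thesis using W.a_rcos_self[OF v] by blast
  qed
  have ca: "carrier (quotient_space V W) = (\<lambda>v. W +>\<^bsub>V\<^esub> v) ` carrier V"
    by (auto simp: quotient_space_def A_RCOSETS_def RCOSETS_def a_r_coset_def)
  have z: "\<zero>\<^bsub>quotient_space V W\<^esub> = W +>\<^bsub>V\<^esub> \<zero>\<^bsub>V\<^esub>"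
    by (simp add: quotient_space_def W.a_rcos_const)
  have ad: "(W +>\<^bsub>V\<^esub> x) \<oplus>\<^bsub>quotient_space V W\<^esub> (W +>\<^bsub>V\<^esub> y) = W +>\<^bsub>V\<^esub> (x \<oplus>\<^bsub>V\<^esub> y)"
    if "x \<in> carrier V" "y \<in> carrier V" for x y
    using that by (simp add: quotient_space_def W.a_rcos_sum)
  have sm': "c \<odot>\<^bsub>quotient_space V W\<^esub> (W +>\<^bsub>V\<^esub> v) = W +>\<^bsub>V\<^esub> (c \<odot>\<^bsub>V\<^esub> v)"
    if "c \<in> carrier K" "v \<in> carrier V" for c v
    using sc[OF that] by (simp add: quotient_space_def)
  show ?thesis
    apply (rule vs_criteria)
    subgoal by (rule V.field.field_axioms)
    unfolding ca z
    apply (auto simp: ad sm' V.a_assoc V.smult_assoc1 V.smult_l_distr V.smult_r_distr)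
    subgoal for v by (rule bexI[of _ "\<ominus>\<^bsub>V\<^esub> v"]) (auto simp: ad V.r_neg)
    apply (metis V.a_comm)+
    done
qed

lemma boundary_linear:
  fixes p :: "'a set \<Rightarrow> real ^ 'n"
  shows "linear_map class_ring (force_C1 X) (force_C0 X) (force_boundary X s p)"
  unfolding linear_map_def mod_hom_def mod_hom_axioms_def force_C0_def force_C1_def
  using chain_space_vs[of "edges X", where 'b=real] chain_space_vs[of "vertices X", where 'b="real^'n"]
  by (auto simp: vectorspace_def module_hom_def chain_space_def force_boundary_def fun_eq_iff
      scaleR_add_left algebra_simps sum.distrib scaleR_sum_right)

lemma force_H0_vs:
  fixes p :: "'a set \<Rightarrow> real ^ 'n"
  shows "vectorspace class_ring (force_H0 X s p)"
proof -
  interpret linear_map class_ring "force_C1 X" "force_C0 X" "force_boundary X s p" by (rule boundary_linear)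
  show ?thesis unfolding force_H0_def using quotient_space_vs[OF imT_is_subspace] by (simp add: im_def)
qed

lemma force_H1_vs:
  fixes p :: "'a set \<Rightarrow> real ^ 'n"
  shows "vectorspace class_ring (force_H1 X s p)"
proof -
  interpret linear_map class_ring "force_C1 X" "force_C0 X" "force_boundary X s p" by (rule boundary_linear)
  have "{w \<in> carrier (force_C1 X). force_boundary X s p w = (\<lambda>v. 0)} = kerT"
    unfolding ker_def by (simp add: force_C0_def chain_space_def)
  then show ?thesis unfolding force_H1_def using V.subspace_is_vs[OF kerT_is_subspace] by simp
qed

lemma edge_direction_endpoints:
  fixes p :: "'a set \<Rightarrow> real ^ 'n"
  assumes "endpoints X e = {u, v}" "u \<noteq> v"
  shows "edge_direction X s p e = sgn (s u e *\<^sub>R p u + s v e *\<^sub>R p v)"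
  using assms by (simp add: edge_direction_def)

lemma norm_edge_direction:
  fixes p :: "'a set \<Rightarrow> real ^ 'n"
  assumes d: "diagram X s p" and e: "e \<in> edges X"
  shows "norm (edge_direction X s p e) = 1"
proof -
  have "card (endpoints X e) = 2" using d e card_endpoints by (auto simp: diagram_def)
  then obtain u v where uv: "endpoints X e = {u, v}" "u \<noteq> v" by (auto simp: card_2_iff)
  then have V: "u \<in> vertices X" "v \<in> vertices X" by (auto simp: endpoints_def)
  have sg: "s u e \<in> {1, -1}" "s u e * s v e = -1"
    using d e uv by (auto simp: diagram_def incidence_signs_def)
  have "p u \<noteq> p v" using d V uv(2) by (auto simp: diagram_def inj_on_def)
  then have "s u e *\<^sub>R p u + s v e *\<^sub>R p v \<noteq> 0"
    using sg by (auto simp: add_eq_0_iff)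
  then show ?thesis unfolding edge_direction_endpoints[OF uv] by (simp add: norm_sgn)
qed

end

theory Submission
  imports Defs
begin

text \<open>
  Maxwell's rule is the invariance of the Euler characteristic for the two-term complex
  \<open>\<partial> : \<real>\<^sup>E \<rightarrow> (\<real>\<^sup>n)\<^sup>V\<close> of the force cosheaf. Two applications of rank-nullity give it: applied to
  \<open>\<partial>\<close> itself, \<open>dim im \<partial> + dim H\<^sub>1 = |E|\<close>; applied to the projection of the zero-chains onto
  their quotient by \<open>im \<partial>\<close> (lemma \<open>dim_quotient_space\<close>), \<open>dim H\<^sub>0 + dim im \<partial> = n |V|\<close>.
  Subtracting eliminates the rank of \<open>\<partial>\<close> and leaves \<open>n |V| - |E| = dim H\<^sub>0 - dim H\<^sub>1\<close>. The
  Euclidean motions enter only through the definition of the number of mechanisms, which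
  splits \<open>dim H\<^sub>0\<close> as \<open>n + 1\<close> choose 2 plus \<open>|M|\<close>.

  The dimensions of the two chain spaces come from the explicit basis of chains
  supported at one cell with value a standard basis vector (lemmas \<open>basis_point_chains\<close>
  and \<open>dim_chain_space\<close>).
\<close>

lemma subspace_imp_abelian_subgroup:
  assumes "VectorSpace.subspace K W V"
  shows "abelian_subgroup W V"
proof -
  interpret V: vectorspace K V using assms by (simp add: VectorSpace.subspace_def)
  have sm: "LinearCombinations.submodule K W V" using assms by (simp add: VectorSpace.subspace_def)
  note W = LinearCombinations.submodule.subset[OF sm] LinearCombinations.submodule.zero_closed[OF sm]
    LinearCombinations.submodule.m_closed[OF sm] LinearCombinations.submodule.smult_closed[OF sm]
  have neg: "\<ominus>\<^bsub>V\<^esub> w \<in> W" if "w \<in> W" for w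
    using W(4)[of "\<ominus>\<^bsub>K\<^esub> \<one>\<^bsub>K\<^esub>" w] that W(1) V.smult_minus_1 by auto
  show ?thesis
  proof (rule abelian_subgroupI3)
    show "additive_subgroup W V"
      by (intro additive_subgroup.intro V.add.subgroupI) (use W neg in \<open>auto simp: a_inv_def\<close>)
  qed (rule V.abelian_group_axioms)
qed

text \<open>
  Scalar multiplication on the quotient is a union over all representatives of a coset.
  The map \<open>v \<mapsto> W + v\<close> is linear because all members of that union coincide: two representatives
  differ by an element of \<open>W\<close>, and \<open>W\<close> is closed under scalars.
\<close>

lemma quotient_map_linear:
  assumes WV: "VectorSpace.subspace K W V"
  shows "linear_map K V (quotient_space V W) (\<lambda>v. W +>\<^bsub>V\<^esub> v)"
proof -
  interpret V: vectorspace K V using WV by (simp add: VectorSpace.subspace_def)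
  interpret W: abelian_subgroup W V by (rule subspace_imp_abelian_subgroup[OF WV])
  interpret Q: vectorspace K "quotient_space V W" by (rule quotient_space_vs[OF WV])
  have sm: "LinearCombinations.submodule K W V" using WV by (simp add: VectorSpace.subspace_def)
  have smult: "W +>\<^bsub>V\<^esub> (c \<odot>\<^bsub>V\<^esub> v) = c \<odot>\<^bsub>quotient_space V W\<^esub> (W +>\<^bsub>V\<^esub> v)"
    if c: "c \<in> carrier K" and v: "v \<in> carrier V" for c v
  proof -
    have "W +>\<^bsub>V\<^esub> (c \<odot>\<^bsub>V\<^esub> x) = W +>\<^bsub>V\<^esub> (c \<odot>\<^bsub>V\<^esub> v)" if "x \<in> W +>\<^bsub>V\<^esub> v" for x
    proof -
      obtain w where w: "w \<in> W" "x = w \<oplus>\<^bsub>V\<^esub> v"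
        using \<open>x \<in> _\<close> by (auto simp: a_r_coset_def r_coset_def)
      have "c \<odot>\<^bsub>V\<^esub> x \<in> W +>\<^bsub>V\<^esub> (c \<odot>\<^bsub>V\<^esub> v)"
        using w c v W.a_subset LinearCombinations.submodule.smult_closed[OF sm c w(1)]
        by (auto simp: a_r_coset_def r_coset_def V.smult_r_distr)
      then show ?thesis using W.a_repr_independence' c v by (metis V.smult_closed)
    qed
    then have "(\<Union>x\<in>W +>\<^bsub>V\<^esub> v. W +>\<^bsub>V\<^esub> (c \<odot>\<^bsub>V\<^esub> x)) = W +>\<^bsub>V\<^esub> (c \<odot>\<^bsub>V\<^esub> v)"
      using W.a_rcos_self[OF v] by blast
    then show ?thesis by (simp add: quotient_space_def)
  qed
  have carrier: "W +>\<^bsub>V\<^esub> v \<in> carrier (quotient_space V W)" if "v \<in> carrier V" for v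
    using that by (auto simp: quotient_space_def A_RCOSETS_def RCOSETS_def a_r_coset_def)
  have add: "W +>\<^bsub>V\<^esub> (x \<oplus>\<^bsub>V\<^esub> y) = (W +>\<^bsub>V\<^esub> x) \<oplus>\<^bsub>quotient_space V W\<^esub> (W +>\<^bsub>V\<^esub> y)"
    if "x \<in> carrier V" "y \<in> carrier V" for x y
    using that by (simp add: quotient_space_def W.a_rcos_sum)
  have "(\<lambda>v. W +>\<^bsub>V\<^esub> v) \<in> module_hom K V (quotient_space V W)"
    unfolding module_hom_def by (intro CollectI conjI Pi_I allI impI carrier add smult) simp_all
  then show ?thesis
    by (intro linear_map.intro mod_hom.intro mod_hom_axioms.intro
        V.vectorspace_axioms Q.vectorspace_axioms V.module_axioms Q.module_axioms)
qed

text \<open>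
  This is rank-nullity for the projection, which is onto with kernel \<open>W\<close>.
\<close>

lemma dim_quotient_space:
  assumes WV: "VectorSpace.subspace K W V" and fin: "vectorspace.fin_dim K V"
  shows "vectorspace.dim K (quotient_space V W) + vectorspace.dim K (V\<lparr>carrier := W\<rparr>)
    = vectorspace.dim K V"
proof -
  let ?Q = "quotient_space V W"
  interpret Q: linear_map K V ?Q "\<lambda>v. W +>\<^bsub>V\<^esub> v" by (rule quotient_map_linear[OF WV])
  interpret W: abelian_subgroup W V by (rule subspace_imp_abelian_subgroup[OF WV])
  have "Q.imT = carrier ?Q"
    unfolding Q.im_def by (auto simp: quotient_space_def A_RCOSETS_def RCOSETS_def a_r_coset_def)
  moreover have "Q.kerT = W"
  proof -
    have "W +>\<^bsub>V\<^esub> v = W \<longleftrightarrow> v \<in> W" if "v \<in> carrier V" for v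
      using W.a_rcos_self[OF that] W.a_rcos_const by blast
    then have "{v \<in> carrier V. W +>\<^bsub>V\<^esub> v = W} = W"
      using W.a_subset by blast
    then show ?thesis
      by (simp only: Q.ker_def) (simp add: quotient_space_def)
  qed
  ultimately show ?thesis
    using Q.rank_nullity[OF fin] by simp
qed

lemma finsum_chain_space:
  assumes "g \<in> S \<rightarrow> carrier (chain_space A :: (real, 'c \<Rightarrow> 'b::real_vector) module)"
  shows "finsum (chain_space A) g S = (\<lambda>x. \<Sum>s\<in>S. g s x)"
proof -
  interpret C: vectorspace class_ring "chain_space A :: (real, 'c \<Rightarrow> 'b) module"
    by (rule chain_space_vs)
  show ?thesis
  proof (cases "finite S")
    case True
    then show ?thesis using assms
      by (induction S) (simp_all, simp_all add: chain_space_def)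
  next
    case False
    then show ?thesis
      by simp (simp add: chain_space_def)
  qed
qed

definition point_chain :: "'c \<times> 'b \<Rightarrow> 'c \<Rightarrow> 'b::zero" where
  "point_chain = (\<lambda>(a, b) x. if x = a then b else 0)"

lemma inj_on_point_chain:
  fixes A :: "'c set"
  shows "inj_on point_chain (A \<times> (Basis :: 'b::euclidean_space set))"
proof (rule inj_onI, clarify)
  fix a a' :: 'c and b b' :: 'b
  assume eq: "point_chain (a, b) = point_chain (a', b')" and b: "b \<in> Basis"
  have "b = (if a = a' then b' else 0)"
    using fun_cong[OF eq, of a] by (simp add: point_chain_def)
  with nonzero_Basis[OF b] show "a = a' \<and> b = b'"
    by (simp split: if_splits)
qed

text \<open>
  At a cell \<open>x\<close> only the chains supported at \<open>x\<close> survive, so a combination of point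
  chains has as its value at \<open>x\<close> a combination of standard basis vectors. Independence and
  spanning can therefore both be checked one cell at a time, in the coefficient space.
\<close>

lemma lincomb_point_chains:
  fixes A :: "'c set" and c :: "('c \<Rightarrow> 'b::euclidean_space) \<Rightarrow> real"
  assumes A: "finite A"
  shows "LinearCombinations.module.lincomb (chain_space A) c (point_chain ` (A \<times> Basis))
    = (\<lambda>x. if x \<in> A then \<Sum>b\<in>Basis. c (point_chain (x, b)) *\<^sub>R b else 0)"
proof -
  interpret C: vectorspace class_ring "chain_space A :: (real, 'c \<Rightarrow> 'b) module"
    by (rule chain_space_vs)
  let ?B = "point_chain ` (A \<times> (Basis :: 'b set))"
  have "C.lincomb c ?B = (\<lambda>x. \<Sum>v\<in>?B. c v *\<^sub>R v x)"
    unfolding C.lincomb_def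
    by (subst finsum_chain_space) (auto simp: chain_space_def point_chain_def)
  also have "\<dots> = (\<lambda>x. \<Sum>a\<in>A. \<Sum>b\<in>Basis. c (point_chain (a, b)) *\<^sub>R point_chain (a, b) x)"
    by (simp add: sum.reindex[OF inj_on_point_chain] sum.cartesian_product case_prod_beta)
  also have "\<dots> = (\<lambda>x. \<Sum>a\<in>A. if a = x then \<Sum>b\<in>Basis. c (point_chain (a, b)) *\<^sub>R b else 0)"
    by (intro ext sum.cong) (auto simp: point_chain_def)
  finally show ?thesis using A by simp
qed

lemma basis_point_chains:
  fixes A :: "'c set"
  assumes A: "finite A"
  shows "vectorspace.basis class_ring (chain_space A)
    (point_chain ` (A \<times> (Basis :: 'b::euclidean_space set)))"
proof -
  interpret C: vectorspace class_ring "chain_space A :: (real, 'c \<Rightarrow> 'b) module"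
    by (rule chain_space_vs)
  let ?B = "point_chain ` (A \<times> (Basis :: 'b set))"
  have finB: "finite ?B" using A by simp
  have carB: "?B \<subseteq> carrier (chain_space A)"
    by (auto simp: chain_space_def point_chain_def)
  have "C.lin_indpt ?B"
  proof (rule C.finite_lin_indpt2[OF finB carB])
    fix c :: "('c \<Rightarrow> 'b) \<Rightarrow> real"
    assume "C.lincomb c ?B = \<zero>\<^bsub>chain_space A\<^esub>"
    then have "(\<Sum>b\<in>Basis. c (point_chain (a, b)) *\<^sub>R b) = 0" if "a \<in> A" for a
      unfolding lincomb_point_chains[OF A] using that
      by (auto simp: chain_space_def dest: fun_cong[where x = a])
    then have "c (point_chain (a, b)) = 0" if "a \<in> A" "b \<in> Basis" for a and b :: 'b
      using that independentD[OF independent_Basis finite_Basis subset_refl,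
          of "\<lambda>b. c (point_chain (a, b))"] by simp
    then show "\<forall>v\<in>?B. c v = \<zero>\<^bsub>class_ring\<^esub>"
      by auto
  qed
  moreover have "f \<in> C.span ?B" if f: "f \<in> carrier (chain_space A)" for f
  proof -
    \<comment> \<open>The coefficient of a point chain is the matching coordinate of \<open>f\<close>; injectivity lets the
      position and the direction be read off from the chain.\<close>
    define c where "c v = (case inv_into (A \<times> Basis) point_chain v of (a, b) \<Rightarrow> inner (f a) b)" for v
    have c: "c (point_chain (a, b)) = inner (f a) b" if "a \<in> A" "b \<in> Basis" for a b
      unfolding c_def using inv_into_f_f[OF inj_on_point_chain, of "(a, b)" A] that by simp
    have "C.lincomb c ?B = f"
      unfolding lincomb_point_chains[OF A]
      using f by (auto simp: c euclidean_representation chain_space_def)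
    then show ?thesis
      using C.finite_span[OF finB carB] by auto
  qed
  ultimately show ?thesis
    unfolding C.basis_def using carB C.span_is_subset2[OF carB] by auto
qed

lemma chain_space_fin_dim:
  assumes "finite A"
  shows "vectorspace.fin_dim class_ring
    (chain_space A :: (real, 'c \<Rightarrow> 'b::euclidean_space) module)"
proof -
  interpret C: vectorspace class_ring "chain_space A :: (real, 'c \<Rightarrow> 'b) module"
    by (rule chain_space_vs)
  show ?thesis
    using basis_point_chains[OF assms, where 'b = 'b] assms unfolding C.basis_def C.fin_dim_def
    by (metis finite_Basis finite_SigmaI finite_imageI)
qed

lemma dim_chain_space:
  assumes "finite A"
  shows "vectorspace.dim class_ring (chain_space A :: (real, 'c \<Rightarrow> 'b::euclidean_space) module)
    = DIM('b) * card A"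
proof -
  interpret C: vectorspace class_ring "chain_space A :: (real, 'c \<Rightarrow> 'b) module"
    by (rule chain_space_vs)
  show ?thesis
    using C.dim_basis[OF _ basis_point_chains[OF assms]] assms
    by (simp add: card_image[OF inj_on_point_chain] card_cartesian_product)
qed

text \<open>
  The rank of the boundary map is subtracted once in \<open>H\<^sub>0\<close> and once in \<open>H\<^sub>1\<close>, so it drops out
  of the difference and only the sizes of the two chain spaces remain.
\<close>

lemma force_euler_characteristic:
  fixes p :: "'a set \<Rightarrow> real ^ 'n"
  assumes fin: "finite (cells X)"
  shows "int CARD('n) * int (card (vertices X)) - int (card (edges X)) =
    int (vectorspace.dim class_ring (force_H0 X s p)) -
    int (vectorspace.dim class_ring (force_H1 X s p))"
proof -
  interpret D: linear_map class_ring "force_C1 X" "force_C0 X" "force_boundary X s p"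
    by (rule boundary_linear)
  have fV: "finite (vertices X)" and fE: "finite (edges X)"
    using fin by (auto simp: vertices_def edges_def)
  have ker: "(force_C1 X)\<lparr>carrier := D.kerT\<rparr> = force_H1 X s p"
    by (simp add: force_H1_def D.ker_def) (simp add: force_C0_def chain_space_def)
  have quot: "quotient_space (force_C0 X) D.imT = force_H0 X s p"
    by (simp add: force_H0_def D.im_def)
  have "vectorspace.dim class_ring ((force_C0 X)\<lparr>carrier := D.imT\<rparr>)
      + vectorspace.dim class_ring (force_H1 X s p) = card (edges X)"
    using D.rank_nullity chain_space_fin_dim[OF fE, where 'b = real]
      dim_chain_space[OF fE, where 'b = real]
    unfolding ker by (simp add: force_C1_def)
  moreover have "vectorspace.dim class_ring (force_H0 X s p)
      + vectorspace.dim class_ring ((force_C0 X)\<lparr>carrier := D.imT\<rparr>)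
      = CARD('n) * card (vertices X)"
    using dim_quotient_space[OF D.imT_is_subspace] chain_space_fin_dim[OF fV, where 'b = "real ^ 'n"]
      dim_chain_space[OF fV, where 'b = "real ^ 'n"]
    unfolding quot by (simp add: force_C0_def)
  ultimately show ?thesis
    by (simp flip: of_nat_mult of_nat_add)
qed

theorem mainTheorem4:
  fixes X :: "'a cell_complex"
    and s :: "'a set \<Rightarrow> 'a set \<Rightarrow> real"
    and p :: "'a set \<Rightarrow> real ^ 'n"
  assumes "diagram X s p"
  shows "int CARD('n) * int (card (vertices X)) - int (card (edges X)) =
         int ((CARD('n) + 1) choose 2) + num_mechanisms X s p - int (num_self_stresses X s p)"
proof -
  have "finite (cells X)"
    using assms by (simp add: diagram_def finite_regular_cell_complex_def)
  then show ?thesis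
    using force_euler_characteristic[of X s p]
    by (simp add: num_mechanisms_def num_self_stresses_def)
qed

end
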